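(* Let $\Phi=(\Gamma,\phi)$ be a $\mathbb{T}$-gain graph with $\Gamma$ connected. Then \[\max_{\{\mathfrak g,\mathfrak g^{-1}\}\in\mathfrak U}\lambda_1\big(L(\Phi^{\{\mathfrak g,\mathfrak g^{-1}\}})\big)\le\lambda_1(L(\Phi))\le\sum_{\{\mathfrak g,\mathfrak g^{-1}\}\in\mathfrak U}\lambda_1\big(L(\Phi^{\{\mathfrak g,\mathfrak g^{-1}\}})\big).\]
   Context: $\mathbb{T}=\{z\in\mathbb{C}:|z|=1\}$. A $\mathbb{T}$-gain graph $\Phi=(\Gamma,\phi)$: $\Gamma=(V,E)$ finite simple with $V=\{v_1,\dots,v_n\}$, $\phi$ assigns to each oriented edge $e_{ij}$ an element of $\mathbb{T}$ with $\phi(e_{ij})=\phi(e_{ji})^{-1}$. $A(\Phi)_{ij}=\phi(e_{ij})$ if $v_i\sim v_j$, else $0$; $L(\Phi)=D(\Gamma)-A(\Phi)$ with $D(\Gamma)$ the diagonal degree matrix; $\lambda_1$ is the largest eigenvalue. $\mathfrak W$ is the set of gains used by $\phi$ (its image), and $\mathfrak U=\{\{\mathfrak g,\mathfrak g^{-1}\}:\mathfrak g\in\mathfrak W\}$ is the set of inverse pairs. For $\{\mathfrak g,\mathfrak g^{-1}\}\in\mathfrak U$, let $S=\{v_iv_j\in E:\phi(e_{ij})\in\{\mathfrak g,\mathfrak g^{-1}\}\}$; $\Phi^{\{\mathfrak g,\mathfrak g^{-1}\}}$ is the gain graph with vertex set $V$, edge set $S$ and gain function $\phi$ restricted to $S$.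 *)

theory Defs
  imports
    "HOL-Library.FuncSet"
    "Jordan_Normal_Form.Spectral_Radius"
    "Graph_Theory.Graph_Theory"
begin

text \<open>
  A finite simple graph is a symmetric loop-free digraph without parallel arcs: each edge
  \<open>v\<^sub>i v\<^sub>j\<close> gives the two arcs \<open>(i, j)\<close> and \<open>(j, i)\<close>, which are the oriented edges \<open>e\<^sub>i\<^sub>j\<close> and
  \<open>e\<^sub>j\<^sub>i\<close>. The vertices \<open>v\<^sub>1, \<dots>, v\<^sub>n\<close> are numbered \<open>0, \<dots>, n - 1\<close>, to match matrix indices. The
  gain function is only meaningful on the arcs.
\<close>

type_synonym gain_graph = "nat pair_pre_digraph \<times> (nat \<times> nat \<Rightarrow> complex)"

definition T_gain_graph :: "nat \<Rightarrow> gain_graph \<Rightarrow> bool" where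
  "T_gain_graph n \<Phi> \<longleftrightarrow> (case \<Phi> of (G, \<phi>) \<Rightarrow>
     pair_graph G \<and> pverts G = {0..<n} \<and>
     (\<forall>e \<in> parcs G. cmod (\<phi> e) = 1) \<and>
     (\<forall>(i, j) \<in> parcs G. \<phi> (i, j) = inverse (\<phi> (j, i))))"

definition gain_adjacency :: "nat \<Rightarrow> gain_graph \<Rightarrow> complex mat" where
  "gain_adjacency n \<Phi> = (case \<Phi> of (G, \<phi>) \<Rightarrow>
     mat n n (\<lambda>(i, j). if (i, j) \<in> parcs G then \<phi> (i, j) else 0))"

definition degree_matrix :: "nat \<Rightarrow> nat pair_pre_digraph \<Rightarrow> complex mat" where
  "degree_matrix n G =
     mat n n (\<lambda>(i, j). if i = j then of_nat (out_degree (with_proj G) i) else 0)"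

definition gain_laplacian :: "nat \<Rightarrow> gain_graph \<Rightarrow> complex mat" where
  "gain_laplacian n \<Phi> = degree_matrix n (fst \<Phi>) - gain_adjacency n \<Phi>"

text \<open>
  Used only for Hermitian matrices of positive size: their spectrum is a nonempty finite set of
  reals, so restricting to real eigenvalues loses nothing.
\<close>

definition largest_eigenvalue :: "complex mat \<Rightarrow> real" where
  "largest_eigenvalue A = Max {x. eigenvalue A (complex_of_real x)}"

definition gains_used :: "gain_graph \<Rightarrow> complex set" where
  "gains_used \<Phi> = (case \<Phi> of (G, \<phi>) \<Rightarrow> \<phi> ` parcs G)"

definition inverse_pairs :: "gain_graph \<Rightarrow> complex set set" where
  "inverse_pairs \<Phi> = (\<lambda>g. {g, inverse g}) ` gains_used \<Phi>"

text \<open>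
  All vertices are kept, and exactly the arcs with gain in \<open>u\<close>. For \<open>u = {g, inverse g}\<close> this arc
  set is symmetric, so it is again the set of oriented edges of a simple graph.
\<close>

definition gain_subgraph :: "gain_graph \<Rightarrow> complex set \<Rightarrow> gain_graph" where
  "gain_subgraph \<Phi> u = (case \<Phi> of (G, \<phi>) \<Rightarrow>
     (let S = {e \<in> parcs G. \<phi> e \<in> u}
      in (\<lparr>pverts = pverts G, parcs = S\<rparr>, restrict \<phi> S)))"

lemma T_gain_graph_gain_subgraph:
  assumes "T_gain_graph n \<Phi>" and "u \<in> inverse_pairs \<Phi>"
  shows "T_gain_graph n (gain_subgraph \<Phi> u)"
proof -
  obtain G \<phi> where P: "\<Phi> = (G, \<phi>)" by (cases \<Phi>)
  have pg: "pair_graph G" and V: "pverts G = {0..<n}"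
    and m: "\<And>e. e \<in> parcs G \<Longrightarrow> cmod (\<phi> e) = 1"
    and i: "\<And>i j. (i, j) \<in> parcs G \<Longrightarrow> \<phi> (i, j) = inverse (\<phi> (j, i))"
    using assms(1) by (auto simp: T_gain_graph_def P)
  interpret pair_graph G by (fact pg)
  have sy: "(j, i) \<in> parcs G" if "(i, j) \<in> parcs G" for i j
    using that pair_sym_arcs by (auto simp: symmetric_def sym_def)
  obtain g where u: "u = {g, inverse g}"
    using assms(2) by (auto simp: inverse_pairs_def)
  define S where "S = {e \<in> parcs G. \<phi> e \<in> u}"
  have sub: "S \<subseteq> parcs G" by (auto simp: S_def)
  have syS: "(j, i) \<in> S" if "(i, j) \<in> S" for i j
  proof -
    have a: "(i, j) \<in> parcs G" and b: "\<phi> (i, j) \<in> u" using that by (auto simp: S_def)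
    have "\<phi> (j, i) = inverse (\<phi> (i, j))" using i[OF sy[OF a]] .
    then have "\<phi> (j, i) \<in> u" using b by (auto simp: u)
    then show ?thesis using sy[OF a] by (simp add: S_def)
  qed
  have "finite S" using sub pair_finite_arcs finite_subset by blast
  moreover have "sym S" using syS by (auto simp: sym_def)
  ultimately have "pair_graph \<lparr>pverts = pverts G, parcs = S\<rparr>"
    using sub in_arcsD1 in_arcsD2 pair_finite_verts pair_no_loops
    by unfold_locales (auto simp: symmetric_def dest!: subsetD)
  then show ?thesis
    using V m i sub syS
    by (auto simp: T_gain_graph_def gain_subgraph_def P Let_def S_def[symmetric])
qed

end

theory Submission
  imports Defs
begin

text \<open>
  The form \<open>x\<^sup>* L x\<close> of a gain Laplacian is \<open>1/2\<close> times the sum of \<open>|x\<^sub>i - \<phi>(e\<^sub>i\<^sub>j) x\<^sub>j|\<^sup>2\<close> over the arcs,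
  and the arcs of the subgraphs belonging to the inverse pairs partition the arcs of the graph.
  So the form of the whole graph is the sum of the nonnegative forms of the subgraphs, and both
  inequalities follow from \<open>x\<^sup>* L x \<le> \<lambda>\<^sub>1 x\<^sup>* x\<close>, applied to an eigenvector of one of the subgraphs and
  of the whole graph respectively.

  For a Hermitian matrix \<open>A\<close>, the bound \<open>x\<^sup>* A x \<le> \<lambda>\<^sub>1 x\<^sup>* x\<close> needs neither the spectral theorem nor
  compactness: if \<open>c\<close> is the least number with \<open>x\<^sup>* A x \<le> c x\<^sup>* x\<close> for all \<open>x\<close>, then \<open>A - c I\<close> is
  singular, because otherwise a bound on its inverse would allow \<open>c\<close> to be decreased.
\<close>

section \<open>Rayleigh quotients of Hermitian matrices\<close>

lemma cscalar_prod_self: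
  fixes x :: "complex vec"
  shows "x \<bullet>c x = of_real (\<Sum>i<dim_vec x. (cmod (x $ i))\<^sup>2)"
  by (simp add: scalar_prod_def conjugate_complex_def complex_norm_square lessThan_atLeast0
      del: of_real_power)

lemma cscalar_prod_self_nonneg: "0 \<le> Re ((x :: complex vec) \<bullet>c x)"
  by (simp add: cscalar_prod_self sum_nonneg)

lemma cscalar_prod_self_pos:
  fixes x :: "complex vec"
  assumes "x \<in> carrier_vec n" "x \<noteq> 0\<^sub>v n"
  shows "0 < Re (x \<bullet>c x)"
proof -
  obtain k where k: "k < n" "x $ k \<noteq> 0"
    using assms by (auto simp: vec_eq_iff)
  have "0 < (\<Sum>i<dim_vec x. (cmod (x $ i))\<^sup>2)"
    using k assms(1) by (intro sum_pos2[of _ k]) auto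
  then show ?thesis by (simp add: cscalar_prod_self)
qed

lemma cscalar_prod_mult_mat_vec:
  fixes A :: "complex mat"
  assumes "A \<in> carrier_mat n n" "x \<in> carrier_vec n" "y \<in> carrier_vec n"
  shows "(A *\<^sub>v x) \<bullet>c y = (\<Sum>i<n. \<Sum>j<n. A $$ (i, j) * x $ j * cnj (y $ i))"
  using assms
  by (auto simp: scalar_prod_def conjugate_complex_def lessThan_atLeast0 sum_distrib_right
      intro!: sum.cong)

text \<open>By 2ab \<le> a^2 + b^2, a product of two entry moduli of \<open>x\<close> is at most
  \<open>x \<bullet>c x\<close>, so the entry moduli of \<open>A\<close> sum to a valid constant.
  Adding 1 makes it positive, because its reciprocal serves as a step size later.\<close>

lemma quadratic_form_bounded:
  fixes A :: "complex mat"
  assumes A: "A \<in> carrier_mat n n"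
  obtains K where "0 < K"
    "\<And>x. x \<in> carrier_vec n \<Longrightarrow> cmod ((A *\<^sub>v x) \<bullet>c x) \<le> K * Re (x \<bullet>c x)"
proof
  let ?K = "\<Sum>i<n. \<Sum>j<n. cmod (A $$ (i, j))"
  show "0 < 1 + ?K"
    by (intro add_pos_nonneg sum_nonneg) auto
  fix x :: "complex vec" assume x: "x \<in> carrier_vec n"
  define N where "N = Re (x \<bullet>c x)"
  have N: "N = (\<Sum>i<n. (cmod (x $ i))\<^sup>2)"
    using x by (simp add: N_def cscalar_prod_self)
  have le: "(cmod (x $ i))\<^sup>2 \<le> N" if "i < n" for i
    unfolding N using that by (intro member_le_sum) auto
  have "cmod (x $ j) * cmod (x $ i) \<le> N" if "i < n" "j < n" for i j
    using sum_squares_bound[of "cmod (x $ j)" "cmod (x $ i)"] le[OF that(1)] le[OF that(2)]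
    by linarith
  then have "cmod (A $$ (i, j) * x $ j * cnj (x $ i)) \<le> cmod (A $$ (i, j)) * N"
    if "i < n" "j < n" for i j
    using that by (simp add: norm_mult mult.assoc mult_left_mono)
  then have "cmod ((A *\<^sub>v x) \<bullet>c x) \<le> (\<Sum>i<n. \<Sum>j<n. cmod (A $$ (i, j)) * N)"
    unfolding cscalar_prod_mult_mat_vec[OF A x x]
    by (intro order_trans[OF norm_sum] sum_mono) auto
  also have "\<dots> = ?K * N"
    by (simp add: sum_distrib_right)
  also have "\<dots> \<le> (1 + ?K) * N"
    using cscalar_prod_self_nonneg[of x] by (simp add: N_def algebra_simps)
  finally show "cmod ((A *\<^sub>v x) \<bullet>c x) \<le> (1 + ?K) * Re (x \<bullet>c x)"
    by (simp add: N_def)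
qed

section \<open>Hermitian matrices and their maximal eigenvalue\<close>

definition hermitian_mat :: "nat \<Rightarrow> complex mat \<Rightarrow> bool" where
  "hermitian_mat n A \<longleftrightarrow> A \<in> carrier_mat n n \<and> (\<forall>i<n. \<forall>j<n. A $$ (i, j) = cnj (A $$ (j, i)))"

lemma hermitian_mat_cscalar_prod:
  assumes "hermitian_mat n A" "x \<in> carrier_vec n" "y \<in> carrier_vec n"
  shows "(A *\<^sub>v x) \<bullet>c y = cnj ((A *\<^sub>v y) \<bullet>c x)"
proof -
  have A: "A \<in> carrier_mat n n" and h: "\<And>i j. i < n \<Longrightarrow> j < n \<Longrightarrow> A $$ (i, j) = cnj (A $$ (j, i))"
    using assms(1) unfolding hermitian_mat_def by blast+
  have "A $$ (i, j) * x $ j * cnj (y $ i) = cnj (A $$ (j, i) * y $ i * cnj (x $ j))"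
    if "i < n" "j < n" for i j
    by (subst h[OF that]) simp
  then have "(A *\<^sub>v x) \<bullet>c y = (\<Sum>i<n. \<Sum>j<n. cnj (A $$ (j, i) * y $ i * cnj (x $ j)))"
    unfolding cscalar_prod_mult_mat_vec[OF A assms(2,3)]
    by (intro sum.cong) auto
  also have "\<dots> = (\<Sum>j<n. \<Sum>i<n. cnj (A $$ (j, i) * y $ i * cnj (x $ j)))"
    by (rule sum.swap)
  also have "\<dots> = cnj ((A *\<^sub>v y) \<bullet>c x)"
    unfolding cscalar_prod_mult_mat_vec[OF A assms(3,2)] by simp
  finally show ?thesis .
qed

lemma char_matrix_mult_vec_form:
  fixes A :: "complex mat"
  assumes "A \<in> carrier_mat n n" "x \<in> carrier_vec n"
  shows "(char_matrix A c *\<^sub>v x) \<bullet>c x = (A *\<^sub>v x) \<bullet>c x - c * (x \<bullet>c x)"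
proof -
  have "char_matrix A c *\<^sub>v x = A *\<^sub>v x - c \<cdot>\<^sub>v x"
    using assms
    by (intro eq_vecI) (auto simp: char_matrix_def add_scalar_prod_distrib[where n = n])
  then show ?thesis
    using assms by (simp add: minus_scalar_prod_distrib[where n = n])
qed

lemma hermitian_char_matrix:
  assumes "hermitian_mat n A"
  shows "hermitian_mat n (char_matrix A (complex_of_real c))"
proof -
  have A: "A \<in> carrier_mat n n" and h: "\<And>i j. i < n \<Longrightarrow> j < n \<Longrightarrow> A $$ (i, j) = cnj (A $$ (j, i))"
    using assms unfolding hermitian_mat_def by blast+
  show ?thesis
    unfolding hermitian_mat_def using A by (auto simp: char_matrix_def intro: h)
qed

text \<open>Take \<open>y\<close> with \<open>M y = x\<close> and test the form at
  \<open>x + t y\<close>: the first-order change is 2t|x|^2, while the second-order term lowers the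
  value by at most K t^2 |x|^2. The result is still nonpositive, so the form at \<open>x\<close>
  lies strictly below 0 by a multiple of |x|^2.\<close>

lemma hermitian_negative_definite:
  assumes M: "hermitian_mat n M" and inv: "det M \<noteq> 0"
    and neg: "\<And>x. x \<in> carrier_vec n \<Longrightarrow> Re ((M *\<^sub>v x) \<bullet>c x) \<le> 0"
  obtains \<delta> where "0 < \<delta>"
    "\<And>x. x \<in> carrier_vec n \<Longrightarrow> Re ((M *\<^sub>v x) \<bullet>c x) \<le> - \<delta> * Re (x \<bullet>c x)"
proof -
  have Mc: "M \<in> carrier_mat n n" using M by (simp add: hermitian_mat_def)
  from det_non_zero_imp_unit[OF Mc inv, of n] obtain N
    where N: "N \<in> carrier_mat n n" "M * N = 1\<^sub>m n"
    by (auto simp: Units_def ring_mat_def)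
  obtain K where K: "0 < K"
    "\<And>x. x \<in> carrier_vec n \<Longrightarrow> cmod ((N *\<^sub>v x) \<bullet>c x) \<le> K * Re (x \<bullet>c x)"
    using quadratic_form_bounded[OF N(1)] by blast
  show ?thesis
  proof
    show "0 < 1 / K" using K by simp
    fix x :: "complex vec" assume x: "x \<in> carrier_vec n"
    define y where "y = N *\<^sub>v x"
    \<comment> \<open>\<open>1 / K\<close> maximises the guaranteed gain 2t - K t^2; the maximum is
      again \<open>1 / K\<close>, which becomes \<delta>.\<close>
    define t where "t = complex_of_real (1 / K)"
    have y: "y \<in> carrier_vec n" using N x by (simp add: y_def)
    have My: "M *\<^sub>v y = x"
      using Mc N x by (simp add: y_def assoc_mult_mat_vec[symmetric])
    have Mx: "(M *\<^sub>v x) \<bullet>c y = x \<bullet>c x"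
      using hermitian_mat_cscalar_prod[OF M x y] by (simp add: My cscalar_prod_self)
    have xy: "Re (x \<bullet>c y) = Re (y \<bullet>c x)"
      using x y by (auto simp: scalar_prod_def conjugate_complex_def ac_simps intro!: sum.cong)
    have "M *\<^sub>v (x + t \<cdot>\<^sub>v y) = M *\<^sub>v x + t \<cdot>\<^sub>v x"
      using Mc x y by (simp add: mult_add_distrib_mat_vec mult_mat_vec My)
    \<comment> \<open>The two first-order terms agree: one comes from \<open>M y = x\<close>
      directly, the other from self-adjointness of \<open>M\<close>.\<close>
    then have "(M *\<^sub>v (x + t \<cdot>\<^sub>v y)) \<bullet>c (x + t \<cdot>\<^sub>v y)
        = (M *\<^sub>v x) \<bullet>c x + t * (x \<bullet>c x) + t * (x \<bullet>c x) + t * t * (x \<bullet>c y)"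
      using Mc x y
      by (simp add: conjugate_add_vec conjugate_smult_vec add_scalar_prod_distrib[where n = n]
          scalar_prod_add_distrib[where n = n] Mx algebra_simps)
         (simp add: t_def conjugate_complex_def)
    moreover have "Re ((M *\<^sub>v (x + t \<cdot>\<^sub>v y)) \<bullet>c (x + t \<cdot>\<^sub>v y)) \<le> 0"
      using x y by (intro neg) auto
    ultimately have 1: "Re ((M *\<^sub>v x) \<bullet>c x) + 2 / K * Re (x \<bullet>c x) + 1 / K\<^sup>2 * Re (y \<bullet>c x) \<le> 0"
      using xy by (simp add: t_def power2_eq_square)
    have "- (K * Re (x \<bullet>c x)) \<le> Re (y \<bullet>c x)"
      using K(2)[OF x] abs_Re_le_cmod[of "y \<bullet>c x"] unfolding y_def by linarith
    then have "1 / K\<^sup>2 * (- (K * Re (x \<bullet>c x))) \<le> 1 / K\<^sup>2 * Re (y \<bullet>c x)"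
      by (intro mult_left_mono) auto
    then have "- (1 / K * Re (x \<bullet>c x)) \<le> 1 / K\<^sup>2 * Re (y \<bullet>c x)"
      using K(1) by (simp add: power2_eq_square)
    with 1 show "Re ((M *\<^sub>v x) \<bullet>c x) \<le> - (1 / K) * Re (x \<bullet>c x)"
      by simp
  qed
qed

lemma hermitian_maximal_eigenvalue:
  assumes A: "hermitian_mat n A" and n: "0 < n"
  obtains c where "eigenvalue A (complex_of_real c)"
    "\<And>x. x \<in> carrier_vec n \<Longrightarrow> Re ((A *\<^sub>v x) \<bullet>c x) \<le> c * Re (x \<bullet>c x)"
proof -
  have Ac: "A \<in> carrier_mat n n" using A by (simp add: hermitian_mat_def)
  define C where "C = {c. \<forall>x \<in> carrier_vec n. Re ((A *\<^sub>v x) \<bullet>c x) \<le> c * Re (x \<bullet>c x)}"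
  obtain K where "\<And>x. x \<in> carrier_vec n \<Longrightarrow> cmod ((A *\<^sub>v x) \<bullet>c x) \<le> K * Re (x \<bullet>c x)"
    using quadratic_form_bounded[OF Ac] by blast
  then have "K \<in> C"
    unfolding C_def using complex_Re_le_cmod order_trans by blast
  then have ne: "C \<noteq> {}" by auto
  \<comment> \<open>Rayleigh quotients bound \<open>C\<close> from below. This makes the infimum
    exist and, as it is the greatest lower bound, makes it satisfy the defining bound of
    \<open>C\<close> itself.\<close>
  have lb: "Re ((A *\<^sub>v x) \<bullet>c x) / Re (x \<bullet>c x) \<le> c"
    if "x \<in> carrier_vec n" "x \<noteq> 0\<^sub>v n" "c \<in> C" for x c
    using that cscalar_prod_self_pos[OF that(1,2)] by (simp add: C_def divide_le_eq)
  \<comment> \<open>A nonzero vector requires positive size; for n = 0 every real would lie in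
    \<open>C\<close>.\<close>
  have "unit_vec n 0 \<noteq> (0\<^sub>v n :: complex vec)"
    using n by (auto simp: vec_eq_iff)
  then have bdd: "bdd_below C"
    using lb[of "unit_vec n 0"] by (auto intro!: bdd_belowI)
  define c where "c = Inf C"
  have le: "Re ((A *\<^sub>v x) \<bullet>c x) \<le> c * Re (x \<bullet>c x)" if x: "x \<in> carrier_vec n" for x
  proof (cases "x = 0\<^sub>v n")
    case True
    then show ?thesis using Ac by simp
  next
    case False
    have "Re ((A *\<^sub>v x) \<bullet>c x) / Re (x \<bullet>c x) \<le> c"
      unfolding c_def using lb[OF x False] ne by (intro cInf_greatest) auto
    then show ?thesis using cscalar_prod_self_pos[OF x False] by (simp add: divide_le_eq)
  qed
  have "eigenvalue A (complex_of_real c)"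
  proof (rule ccontr)
    let ?M = "char_matrix A (complex_of_real c)"
    assume "\<not> eigenvalue A (complex_of_real c)"
    then have "det ?M \<noteq> 0" using eigenvalue_det[OF Ac] by simp
    moreover have form: "Re ((?M *\<^sub>v x) \<bullet>c x) = Re ((A *\<^sub>v x) \<bullet>c x) - c * Re (x \<bullet>c x)"
      if "x \<in> carrier_vec n" for x
      using char_matrix_mult_vec_form[OF Ac that] by simp
    then have "Re ((?M *\<^sub>v x) \<bullet>c x) \<le> 0" if "x \<in> carrier_vec n" for x
      using le that by simp
    ultimately obtain \<delta> where \<delta>: "0 < \<delta>"
      "\<And>x. x \<in> carrier_vec n \<Longrightarrow> Re ((?M *\<^sub>v x) \<bullet>c x) \<le> - \<delta> * Re (x \<bullet>c x)"
      using hermitian_negative_definite[OF hermitian_char_matrix[OF A]] by blast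
    \<comment> \<open>Undoing the shift by \<open>c\<close> turns the margin \<delta> into a smaller
      admissible bound.\<close>
    then have "c - \<delta> \<in> C"
      by (auto simp: C_def form algebra_simps)
    then have "c \<le> c - \<delta>"
      unfolding c_def by (rule cInf_lower[OF _ bdd])
    with \<delta>(1) show False by simp
  qed
  with le that show ?thesis by blast
qed

text \<open>The \<open>Max\<close> is taken over a finite set, as the spectrum is finite, and a
  nonempty one, as it contains the extremal \<open>c\<close>. Since \<open>c\<close> is at most this
  \<open>Max\<close> and \<open>x \<bullet>c x\<close> is nonnegative, the bound by \<open>c\<close>
  carries over.\<close>

lemma largest_eigenvalue_hermitian:
  assumes A: "hermitian_mat n A" and n: "0 < n"
  shows eigenvalue_largest_eigenvalue: "eigenvalue A (complex_of_real (largest_eigenvalue A))"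
    and quadratic_form_le_largest_eigenvalue:
      "x \<in> carrier_vec n \<Longrightarrow> Re ((A *\<^sub>v x) \<bullet>c x) \<le> largest_eigenvalue A * Re (x \<bullet>c x)"
proof -
  let ?E = "{r. eigenvalue A (complex_of_real r)}"
  have Ac: "A \<in> carrier_mat n n" using A by (simp add: hermitian_mat_def)
  have "?E = complex_of_real -` spectrum A" by (auto simp: spectrum_def)
  then have fin: "finite ?E"
    using card_finite_spectrum(1)[OF Ac] by (simp add: finite_vimageI inj_of_real)
  obtain c where c: "c \<in> ?E"
    "\<And>x. x \<in> carrier_vec n \<Longrightarrow> Re ((A *\<^sub>v x) \<bullet>c x) \<le> c * Re (x \<bullet>c x)"
    using hermitian_maximal_eigenvalue[OF A n] by blast
  show "eigenvalue A (complex_of_real (largest_eigenvalue A))"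
    using Max_in[OF fin] c(1) by (auto simp: largest_eigenvalue_def)
  have "c \<le> largest_eigenvalue A"
    using Max_ge[OF fin c(1)] by (simp add: largest_eigenvalue_def)
  then show "Re ((A *\<^sub>v x) \<bullet>c x) \<le> largest_eigenvalue A * Re (x \<bullet>c x)" if "x \<in> carrier_vec n"
    using c(2)[OF that] cscalar_prod_self_nonneg[of x] mult_right_mono order_trans by blast
qed

text \<open>Supplies the test vectors for both final inequalities: the Rayleigh bound is attained at
  an eigenvector.\<close>

lemma largest_eigenvalue_eigenvector:
  assumes A: "hermitian_mat n A" and n: "0 < n"
  obtains x where "x \<in> carrier_vec n" "0 < Re (x \<bullet>c x)"
    "Re ((A *\<^sub>v x) \<bullet>c x) = largest_eigenvalue A * Re (x \<bullet>c x)"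
proof -
  have "A \<in> carrier_mat n n" using A by (simp add: hermitian_mat_def)
  with eigenvalue_largest_eigenvalue[OF A n] obtain x where
    x: "x \<in> carrier_vec n" "x \<noteq> 0\<^sub>v n" "A *\<^sub>v x = complex_of_real (largest_eigenvalue A) \<cdot>\<^sub>v x"
    by (auto simp: eigenvalue_def eigenvector_def)
  then show ?thesis
    using cscalar_prod_self_pos[OF x(1,2)] by (intro that[of x]) auto
qed

section \<open>The quadratic form of a gain Laplacian\<close>

text \<open>In a gain graph with unit gains, opposite arcs contribute equally, so halving counts
  each edge once.\<close>

definition dirichlet_energy :: "gain_graph \<Rightarrow> complex vec \<Rightarrow> real" where
  "dirichlet_energy \<Phi> x =
     (\<Sum>e \<in> parcs (fst \<Phi>). (cmod (x $ fst e - snd \<Phi> e * x $ snd e))\<^sup>2) / 2"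

text \<open>On the unit circle inversion is conjugation; this is what makes the Laplacian
  Hermitian.\<close>

lemma T_gain_graphD:
  assumes "T_gain_graph n (G, \<phi>)"
  shows "parcs G \<subseteq> {..<n} \<times> {..<n}"
    and "e \<in> parcs G \<Longrightarrow> cmod (\<phi> e) = 1"
    and "(i, j) \<in> parcs G \<Longrightarrow> (j, i) \<in> parcs G"
    and "(i, j) \<in> parcs G \<Longrightarrow> \<phi> (i, j) = cnj (\<phi> (j, i))"
proof -
  have G: "pair_graph G" and V: "pverts G = {0..<n}"
    and m: "\<And>e. e \<in> parcs G \<Longrightarrow> cmod (\<phi> e) = 1"
    and inv: "\<And>i j. (i, j) \<in> parcs G \<Longrightarrow> \<phi> (i, j) = inverse (\<phi> (j, i))"
    using assms by (auto simp: T_gain_graph_def)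
  interpret pair_graph G by (fact G)
  show "parcs G \<subseteq> {..<n} \<times> {..<n}"
    using in_arcsD1 in_arcsD2 V by fastforce
  show "e \<in> parcs G \<Longrightarrow> cmod (\<phi> e) = 1" by (rule m)
  show sy: "(j, i) \<in> parcs G" if "(i, j) \<in> parcs G" for i j
    using that pair_sym_arcs by (auto simp: symmetric_def sym_def)
  show "\<phi> (i, j) = cnj (\<phi> (j, i))" if "(i, j) \<in> parcs G"
    using inv[OF that] m[OF sy[OF that]]
    by (auto intro!: inverse_unique simp flip: complex_norm_square)
qed

lemma hermitian_gain_laplacian:
  assumes "T_gain_graph n \<Phi>"
  shows "hermitian_mat n (gain_laplacian n \<Phi>)"
proof (cases \<Phi>)
  case (Pair G \<phi>)
  note T = T_gain_graphD[OF assms[unfolded Pair]]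
  show ?thesis
    by (auto simp: hermitian_mat_def gain_laplacian_def degree_matrix_def gain_adjacency_def Pair
        intro: T(4) dest: T(3))
qed

text \<open>Spreading each degree over the outgoing arcs gives every arc (i, j) the share |x_i|^2 -
  Re(\<phi>(i, j) x_j cnj x_i). Averaging |x_i|^2 with |x_j|^2 by arc reversal completes the
  square.\<close>

lemma gain_laplacian_form:
  assumes T: "T_gain_graph n \<Phi>" and x: "x \<in> carrier_vec n"
  shows "Re ((gain_laplacian n \<Phi> *\<^sub>v x) \<bullet>c x) = dirichlet_energy \<Phi> x"
proof (cases \<Phi>)
  case (Pair G \<phi>)
  note T' = T_gain_graphD[OF T[unfolded Pair]]
  let ?E = "parcs G" and ?L = "gain_laplacian n \<Phi>"
  have L: "?L \<in> carrier_mat n n"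
    using hermitian_gain_laplacian[OF T] by (simp add: hermitian_mat_def)
  have deg: "out_degree (with_proj G) i = card {j. j < n \<and> (i, j) \<in> ?E}" for i
  proof -
    have "out_arcs (with_proj G) i = Pair i ` {j. j < n \<and> (i, j) \<in> ?E}"
      using T'(1) by (auto simp: out_arcs_def)
    then show ?thesis by (simp add: out_degree_def card_image inj_on_def)
  qed
  have sum_E: "(\<Sum>e \<in> ?E. f e) = (\<Sum>i<n. \<Sum>j<n. if (i, j) \<in> ?E then f (i, j) else 0)"
    for f :: "nat \<times> nat \<Rightarrow> complex"
  proof -
    have "(\<Sum>e \<in> ?E. f e) = (\<Sum>e \<in> {..<n} \<times> {..<n}. if e \<in> ?E then f e else 0)"
      using T'(1) by (intro sum.mono_neutral_cong_left) auto
    then show ?thesis by (simp add: sum.cartesian_product)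
  qed
  have row: "(\<Sum>j<n. ?L $$ (i, j) * x $ j * cnj (x $ i))
      = (\<Sum>j<n. if (i, j) \<in> ?E then (x $ i - \<phi> (i, j) * x $ j) * cnj (x $ i) else 0)"
    if i: "i < n" for i
  proof -
    have "(\<Sum>j<n. ?L $$ (i, j) * x $ j * cnj (x $ i))
        = (\<Sum>j<n. (if i = j then of_nat (out_degree (with_proj G) i) * x $ i * cnj (x $ i) else 0)
            - (if (i, j) \<in> ?E then \<phi> (i, j) * x $ j * cnj (x $ i) else 0))"
      using i by (intro sum.cong)
        (auto simp: gain_laplacian_def degree_matrix_def gain_adjacency_def Pair algebra_simps)
    also have "\<dots> = of_nat (out_degree (with_proj G) i) * x $ i * cnj (x $ i)
        - (\<Sum>j<n. if (i, j) \<in> ?E then \<phi> (i, j) * x $ j * cnj (x $ i) else 0)"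
      using i by (simp add: sum_subtractf)
    also have "of_nat (out_degree (with_proj G) i) * x $ i * cnj (x $ i)
        = (\<Sum>j<n. if (i, j) \<in> ?E then x $ i * cnj (x $ i) else 0)"
      by (simp add: deg sum.If_cases Int_def mult.assoc)
    also have "(\<Sum>j<n. if (i, j) \<in> ?E then x $ i * cnj (x $ i) else 0)
          - (\<Sum>j<n. if (i, j) \<in> ?E then \<phi> (i, j) * x $ j * cnj (x $ i) else 0)
        = (\<Sum>j<n. if (i, j) \<in> ?E then (x $ i - \<phi> (i, j) * x $ j) * cnj (x $ i) else 0)"
      unfolding sum_subtractf[symmetric] by (intro sum.cong) (auto simp: algebra_simps)
    finally show ?thesis .
  qed
  let ?p = "\<lambda>e. Re (\<phi> e * x $ snd e * cnj (x $ fst e))"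
  have "(?L *\<^sub>v x) \<bullet>c x = (\<Sum>e \<in> ?E. (x $ fst e - \<phi> e * x $ snd e) * cnj (x $ fst e))"
    unfolding cscalar_prod_mult_mat_vec[OF L x x] sum_E
    by (rule sum.cong) (simp_all only: lessThan_iff row fst_conv snd_conv)
  moreover have "Re ((a - b) * cnj a) = (cmod a)\<^sup>2 - Re (b * cnj a)" for a b
    by (simp add: cmod_power2) (simp add: power2_eq_square algebra_simps)
  ultimately have "Re ((?L *\<^sub>v x) \<bullet>c x) = (\<Sum>e \<in> ?E. (cmod (x $ fst e))\<^sup>2 - ?p e)"
    by (simp only: Re_sum)
  also have "\<dots> = (\<Sum>e \<in> ?E. (cmod (x $ fst e))\<^sup>2) - (\<Sum>e \<in> ?E. ?p e)"
    by (rule sum_subtractf)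
  finally have form:
    "Re ((?L *\<^sub>v x) \<bullet>c x) = (\<Sum>e \<in> ?E. (cmod (x $ fst e))\<^sup>2) - (\<Sum>e \<in> ?E. ?p e)" .
  \<comment> \<open>Reversal permutes the arcs, so tails and heads carry the same total
    weight.\<close>
  have swap: "(\<Sum>e \<in> ?E. (cmod (x $ fst e))\<^sup>2) = (\<Sum>e \<in> ?E. (cmod (x $ snd e))\<^sup>2)"
    by (rule sum.reindex_bij_witness[of _ prod.swap prod.swap]) (auto dest: T'(3))
  \<comment> \<open>Modulus 1 of the gain removes it from the second square.\<close>
  have sq: "(cmod (x $ fst e - \<phi> e * x $ snd e))\<^sup>2
      = (cmod (x $ fst e))\<^sup>2 + (cmod (x $ snd e))\<^sup>2 - 2 * ?p e" if "e \<in> ?E" for e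
  proof -
    have "(cmod (a - b))\<^sup>2 = (cmod a)\<^sup>2 + (cmod b)\<^sup>2 - 2 * Re (b * cnj a)" for a b
      by (simp add: cmod_power2) (simp add: power2_eq_square algebra_simps)
    from this[of "x $ fst e" "\<phi> e * x $ snd e"] show ?thesis
      using T'(2)[OF that] by (simp add: norm_mult)
  qed
  have "2 * dirichlet_energy \<Phi> x
      = (\<Sum>e \<in> ?E. (cmod (x $ fst e))\<^sup>2 + (cmod (x $ snd e))\<^sup>2 - 2 * ?p e)"
    unfolding dirichlet_energy_def Pair by (simp add: sq)
  also have "\<dots> = 2 * Re ((?L *\<^sub>v x) \<bullet>c x)"
    unfolding form sum_subtractf sum.distrib swap[symmetric] sum_distrib_left[symmetric] by simp
  finally show ?thesis by simp
qed

section \<open>Splitting the energy over the inverse pairs of gains\<close>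

lemma dirichlet_energy_nonneg: "0 \<le> dirichlet_energy \<Phi> x"
  by (simp add: dirichlet_energy_def sum_nonneg)

lemma finite_inverse_pairs:
  assumes "T_gain_graph n \<Phi>"
  shows "finite (inverse_pairs \<Phi>)"
proof (cases \<Phi>)
  case (Pair G \<phi>)
  have "finite (parcs G)"
    using T_gain_graphD(1)[OF assms[unfolded Pair]] finite_subset by blast
  then show ?thesis by (simp add: inverse_pairs_def gains_used_def Pair)
qed

text \<open>Each arc belongs to exactly one subgraph, the one of its own pair
  \<open>{\<phi> e, inverse (\<phi> e)}\<close>, and restriction does not change its gain.\<close>

lemma dirichlet_energy_sum_inverse_pairs:
  assumes "T_gain_graph n \<Phi>"
  shows "dirichlet_energy \<Phi> x = (\<Sum>u \<in> inverse_pairs \<Phi>. dirichlet_energy (gain_subgraph \<Phi> u) x)"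
proof (cases \<Phi>)
  case (Pair G \<phi>)
  let ?h = "\<lambda>e. (cmod (x $ fst e - \<phi> e * x $ snd e))\<^sup>2"
  let ?cls = "\<lambda>e. {\<phi> e, inverse (\<phi> e)}"
  have fin: "finite (parcs G)"
    using T_gain_graphD(1)[OF assms[unfolded Pair]] finite_subset by blast
  \<comment> \<open>As inversion is an involution, both members of a pair generate it. The arc sets
    are therefore fibres of \<open>?cls\<close>, the form that \<open>sum.group\<close>
    expects.\<close>
  have "{e \<in> parcs G. ?cls e = u} = {e \<in> parcs G. \<phi> e \<in> u}" if "u \<in> inverse_pairs \<Phi>" for u
    using that by (auto simp: inverse_pairs_def)
  then have "dirichlet_energy (gain_subgraph \<Phi> u) x = (\<Sum>e \<in> {e \<in> parcs G. ?cls e = u}. ?h e) / 2"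
    if "u \<in> inverse_pairs \<Phi>" for u
    using that by (simp add: dirichlet_energy_def gain_subgraph_def Pair Let_def)
  then have "(\<Sum>u \<in> inverse_pairs \<Phi>. dirichlet_energy (gain_subgraph \<Phi> u) x)
      = (\<Sum>u \<in> inverse_pairs \<Phi>. \<Sum>e \<in> {e \<in> parcs G. ?cls e = u}. ?h e) / 2"
    by (simp add: sum_divide_distrib)
  also have "(\<Sum>u \<in> inverse_pairs \<Phi>. \<Sum>e \<in> {e \<in> parcs G. ?cls e = u}. ?h e) = sum ?h (parcs G)"
    by (intro sum.group fin finite_inverse_pairs[OF assms])
       (auto simp: inverse_pairs_def gains_used_def Pair)
  finally show ?thesis by (simp add: dirichlet_energy_def Pair)
qed

text \<open>The guard covers a graph without arcs, where \<open>Max\<close> would range over the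
  empty set. Being connected, such a graph is a single vertex, and the upper bound reads 0 \<le>
  0.\<close>

theorem theorem4p10:
  fixes n :: nat and \<Phi> :: gain_graph
  assumes "T_gain_graph n \<Phi>"
    and "Digraph_Component.connected (with_proj (fst \<Phi>))"
  shows "(inverse_pairs \<Phi> \<noteq> {} \<longrightarrow>
           Max ((\<lambda>u. largest_eigenvalue (gain_laplacian n (gain_subgraph \<Phi> u))) ` inverse_pairs \<Phi>)
             \<le> largest_eigenvalue (gain_laplacian n \<Phi>))
       \<and> largest_eigenvalue (gain_laplacian n \<Phi>)
             \<le> (\<Sum>u \<in> inverse_pairs \<Phi>. largest_eigenvalue (gain_laplacian n (gain_subgraph \<Phi> u)))"
proof -
  let ?U = "inverse_pairs \<Phi>"
  let ?top = "largest_eigenvalue (gain_laplacian n \<Phi>)"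
  let ?ev = "\<lambda>u. largest_eigenvalue (gain_laplacian n (gain_subgraph \<Phi> u))"
  note T = assms(1)
  note H = hermitian_gain_laplacian[OF T]
  note Tu = T_gain_graph_gain_subgraph[OF T]
  note Hu = hermitian_gain_laplacian[OF Tu]
  \<comment> \<open>Connectedness includes having a vertex, which gives the positive size that the
    eigenvalue lemmas require.\<close>
  have "pverts (fst \<Phi>) \<noteq> {}"
    using assms(2) by (auto simp: connected_def strongly_connected_def mk_symmetric_def)
  then have n: "0 < n"
    using T by (auto simp: T_gain_graph_def split: prod.splits)
  have lower: "?ev u \<le> ?top" if u: "u \<in> ?U" for u
  proof -
    obtain x where x: "x \<in> carrier_vec n" "0 < Re (x \<bullet>c x)"
      "Re ((gain_laplacian n (gain_subgraph \<Phi> u) *\<^sub>v x) \<bullet>c x) = ?ev u * Re (x \<bullet>c x)"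
      using largest_eigenvalue_eigenvector[OF Hu[OF u] n] by blast
    have "?ev u * Re (x \<bullet>c x) = dirichlet_energy (gain_subgraph \<Phi> u) x"
      using gain_laplacian_form[OF Tu[OF u] x(1)] x(3) by simp
    \<comment> \<open>The other pairs only add nonnegative energy.\<close>
    also have "\<dots> \<le> dirichlet_energy \<Phi> x"
      unfolding dirichlet_energy_sum_inverse_pairs[OF T]
      using u by (intro member_le_sum dirichlet_energy_nonneg finite_inverse_pairs[OF T])
    also have "\<dots> \<le> ?top * Re (x \<bullet>c x)"
      using quadratic_form_le_largest_eigenvalue[OF H n x(1)] gain_laplacian_form[OF T x(1)] by simp
    finally show ?thesis using x(2) by simp
  qed
  obtain x where x: "x \<in> carrier_vec n" "0 < Re (x \<bullet>c x)"
    "Re ((gain_laplacian n \<Phi> *\<^sub>v x) \<bullet>c x) = ?top * Re (x \<bullet>c x)"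
    using largest_eigenvalue_eigenvector[OF H n] by blast
  have "?top * Re (x \<bullet>c x) = (\<Sum>u \<in> ?U. dirichlet_energy (gain_subgraph \<Phi> u) x)"
    using gain_laplacian_form[OF T x(1)] x(3) dirichlet_energy_sum_inverse_pairs[OF T] by simp
  \<comment> \<open>The one vector \<open>x\<close> is tested in every subgraph, where it need not
    be an eigenvector.\<close>
  also have "\<dots> \<le> (\<Sum>u \<in> ?U. ?ev u * Re (x \<bullet>c x))"
    using quadratic_form_le_largest_eigenvalue[OF Hu n x(1)] gain_laplacian_form[OF Tu x(1)]
    by (intro sum_mono) simp
  finally have "?top \<le> (\<Sum>u \<in> ?U. ?ev u)"
    using x(2) by (simp add: sum_distrib_right[symmetric])
  then show ?thesis
    using lower finite_inverse_pairs[OF T] by auto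
qed

end
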